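(* Let $X,Y$ be compact Hausdorff spaces and let $h:X\to Y$, $t:Y\to \mathrm{Sym}^n(X)$ be an $n$-branched covering. Then the direct image $t_!:C(X)\to C(Y)$ is an $n$-transfer for the ring homomorphism $h^*:C(Y)\to C(X)$, $h^*(\psi)=\psi\circ h$.
   Context: $\mathrm{Sym}^n(X)=X^n/\Sigma_n$ is the $n$-th symmetric product (with the quotient topology); its points are $n$-multisets $[x_1,\dots,x_n]$ of points of $X$. A continuous map $h:X\to Y$ induces $\mathrm{Sym}^n(h):\mathrm{Sym}^n(X)\to\mathrm{Sym}^n(Y)$, $[x_1,\dots,x_n]\mapsto[h(x_1),\dots,h(x_n)]$. $n$-branched covering: a continuous map $h:X\to Y$ between Hausdorff spaces together with a continuous map $t:Y\to\mathrm{Sym}^n(X)$ such that (i) $x\in t(h(x))$ for every $x\in X$; (ii) $\mathrm{Sym}^n(h)(t(y))=ny$ for every $y\in Y$, where $ny=[y,\dots,y]$ denotes the multiset consisting of $y$ with multiplicity $n$. $C(X)$ is the algebra of continuous functions $X\to\mathbb{C}$ with the supremum norm. The direct image $t_!:C(X)\to C(Y)$ of a continuous map $t:Y\to\mathrm{Sym}^n(X)$ is $(t_!\phi)(y)=\sum_{r=1}^n\phi(x_r)$, where $t(y)=[x_1,\dots,x_n]$. All algebras are commutative, associative, unital $\mathbb{C}$-algebras. For a linear map $f:A\to B$ and $n\ge1$, define $\Phi_n(f):A^{\otimes n}\to B$ by $\Phi_n(f)(a_1,\dots,a_n)=\sum_{\sigma\in\Sigma_n}\varepsilon_\sigma f_{\gamma_1}(a_1,\dots,a_n)\cdots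 f_{\gamma_r}(a_1,\dots,a_n)$, where $\sigma=\gamma_1\cdots\gamma_r$ is the decomposition into disjoint cycles of total length $n$ (cycles of length 1 included), $\varepsilon_\sigma$ is the sign of $\sigma$, and $f_\gamma(a_1,\dots,a_n)=f(a_{i_1}a_{i_2}\cdots a_{i_m})$ for a cycle $\gamma=(i_1\dots i_m)$. A linear map $f:A\to B$ is a Frobenius $n$-homomorphism if $f(1)=n$ and $\Phi_{n+1}(f)\equiv0$ (for $n=0$ this means $f=0$). $n$-transfer: for a ring homomorphism $f:A\to B$, a linear map $\tau:B\to A$ is an $n$-transfer for $f$ if (i) $\tau$ is a Frobenius $n$-homomorphism; (ii) $\tau(f(a)b)=a\tau(b)$ for all $a\in A$, $b\in B$; (iii) $f\tau:B\to B$ is the sum of the identity and a Frobenius $(n-1)$-homomorphism $g:B\to B$. *)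

theory Defs
  imports "HOL-Analysis.Analysis" "HOL-Algebra.Module" "HOL-Combinatorics.Orbits"
begin

section \<open>Symmetric products and branched coverings\<close>

text \<open>Points of \<open>Sym\<^sup>n(X)\<close> are the multisets of size \<open>n\<close> of points of \<open>X\<close>;
  the projection \<open>X\<^sup>n \<rightarrow> Sym\<^sup>n(X)\<close> forgets the order of a tuple. Tuples are extensional
  functions on \<open>{1..n}\<close>. The lemmas \<open>quotient_map_Sym\<close> and \<open>tuple_mset_eq_iff\<close> below show that
  this is the quotient of \<open>X\<^sup>n\<close> by the permutation action.\<close>

definition tuple_mset :: "nat \<Rightarrow> (nat \<Rightarrow> 'a) \<Rightarrow> 'a multiset" where
  "tuple_mset n x = image_mset x (mset_set {1..n})"

definition Sym :: "nat \<Rightarrow> 'a topology \<Rightarrow> 'a multiset topology" where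
  "Sym n X = topology (\<lambda>U. U \<subseteq> {M. size M = n \<and> set_mset M \<subseteq> topspace X} \<and>
     openin (product_topology (\<lambda>_. X) {1..n})
       {x \<in> topspace (product_topology (\<lambda>_. X) {1..n}). tuple_mset n x \<in> U})"

definition branched_covering ::
    "nat \<Rightarrow> 'a topology \<Rightarrow> 'b topology \<Rightarrow> ('a \<Rightarrow> 'b) \<Rightarrow> ('b \<Rightarrow> 'a multiset) \<Rightarrow> bool" where
  "branched_covering n X Y h t \<longleftrightarrow>
     Hausdorff_space X \<and> Hausdorff_space Y \<and>
     continuous_map X Y h \<and> continuous_map Y (Sym n X) t \<and>
     (\<forall>x\<in>topspace X. x \<in># t (h x)) \<and>
     (\<forall>y\<in>topspace Y. image_mset h (t y) = replicate_mset n y)"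

lemma openin_Sym:
  "openin (Sym n X) U \<longleftrightarrow> U \<subseteq> {M. size M = n \<and> set_mset M \<subseteq> topspace X} \<and>
     openin (product_topology (\<lambda>_. X) {1..n})
       {x \<in> topspace (product_topology (\<lambda>_. X) {1..n}). tuple_mset n x \<in> U}"
  (is "_ \<longleftrightarrow> ?L U")
proof -
  let ?P = "product_topology (\<lambda>_. X) {1..n}"
  have "istopology ?L"
    unfolding istopology_def
  proof (intro conjI allI impI)
    fix S T assume ST: "?L S" "?L T"
    then show "S \<inter> T \<subseteq> {M. size M = n \<and> set_mset M \<subseteq> topspace X}" by blast
    have "{x \<in> topspace ?P. tuple_mset n x \<in> S \<inter> T} =
       {x \<in> topspace ?P. tuple_mset n x \<in> S} \<inter> {x \<in> topspace ?P. tuple_mset n x \<in> T}"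
      by blast
    with ST show "openin ?P {x \<in> topspace ?P. tuple_mset n x \<in> S \<inter> T}"
      by (metis (no_types, lifting) openin_Int)
  next
    fix K assume K: "\<forall>S\<in>K. ?L S"
    then show "\<Union>K \<subseteq> {M. size M = n \<and> set_mset M \<subseteq> topspace X}" by blast
    have "{x \<in> topspace ?P. tuple_mset n x \<in> \<Union>K} =
       (\<Union>S\<in>K. {x \<in> topspace ?P. tuple_mset n x \<in> S})"
      by blast
    with K show "openin ?P {x \<in> topspace ?P. tuple_mset n x \<in> \<Union>K}"
      by (metis (no_types, lifting) openin_Union imageE)
  qed
  then show ?thesis
    by (simp add: Sym_def topology_inverse')
qed

lemma tuple_mset_image:
  "tuple_mset n ` topspace (product_topology (\<lambda>_. X) {1..n}) =
     {M. size M = n \<and> set_mset M \<subseteq> topspace X}"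
proof (intro equalityI subsetI)
  fix M assume "M \<in> tuple_mset n ` topspace (product_topology (\<lambda>_. X) {1..n})"
  then show "M \<in> {M. size M = n \<and> set_mset M \<subseteq> topspace X}"
    by (auto simp: tuple_mset_def PiE_iff)
next
  fix M assume M: "M \<in> {M. size M = n \<and> set_mset M \<subseteq> topspace X}"
  obtain xs where xs: "mset xs = M" using ex_mset by blast
  with M have len: "length xs = n" and sub: "set xs \<subseteq> topspace X" by auto
  define x where "x = (\<lambda>i\<in>{1..n}. xs ! (i - 1))"
  have "x \<in> topspace (product_topology (\<lambda>_. X) {1..n})"
  proof -
    have "xs ! (i - 1) \<in> topspace X" if "i \<in> {1..n}" for i
      using nth_mem[of "i - 1" xs] len sub that by fastforce
    then show ?thesis by (auto simp: x_def)
  qed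
  moreover have "tuple_mset n x = M"
  proof -
    have "tuple_mset n x = image_mset (\<lambda>i. xs ! (i - 1)) (mset_set {1..n})"
      unfolding tuple_mset_def by (rule image_mset_cong) (simp add: x_def)
    also have "mset_set {1..n} = image_mset Suc (mset_set {0..<n})"
      by (subst image_mset_mset_set) (auto simp: image_Suc_atLeastLessThan atLeastLessThanSuc_atLeastAtMost)
    also have "image_mset (\<lambda>i. xs ! (i - 1)) \<dots> = image_mset ((!) xs) (mset_set {0..<n})"
      by (simp add: multiset.map_comp o_def)
    also have "\<dots> = mset (map ((!) xs) [0..<length xs])"
      using len by simp
    also have "\<dots> = M" by (simp only: map_nth xs)
    finally show ?thesis .
  qed
  ultimately show "M \<in> tuple_mset n ` topspace (product_topology (\<lambda>_. X) {1..n})" by blast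
qed

lemma topspace_Sym: "topspace (Sym n X) = {M. size M = n \<and> set_mset M \<subseteq> topspace X}"
proof -
  let ?P = "product_topology (\<lambda>_. X) {1..n}"
  let ?W = "{M. size M = n \<and> set_mset M \<subseteq> topspace X}"
  have "{x \<in> topspace ?P. tuple_mset n x \<in> ?W} = topspace ?P"
    using tuple_mset_image[of n X] by blast
  then have "openin (Sym n X) ?W"
    unfolding openin_Sym by (metis (no_types, lifting) openin_topspace order_refl)
  then have "?W \<subseteq> topspace (Sym n X)" by (rule openin_subset)
  moreover have "topspace (Sym n X) \<subseteq> ?W"
    using openin_topspace[of "Sym n X"] unfolding openin_Sym by blast
  ultimately show ?thesis by blast
qed

lemma quotient_map_Sym:
  "quotient_map (product_topology (\<lambda>_. X) {1..n}) (Sym n X) (tuple_mset n)"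
  unfolding quotient_map_def topspace_Sym openin_Sym using tuple_mset_image[of n X] by blast

lemma tuple_mset_eq_iff:
  "tuple_mset n x = tuple_mset n y \<longleftrightarrow> (\<exists>\<sigma>. \<sigma> permutes {1..n} \<and> (\<forall>i\<in>{1..n}. y i = x (\<sigma> i)))"
proof
  assume "tuple_mset n x = tuple_mset n y"
  then have "image_mset x (mset_set {1..n}) = image_mset y (mset_set {1..n})"
    by (simp add: tuple_mset_def)
  from image_mset_eq_implies_permutes[OF _ this[symmetric]]
  show "\<exists>\<sigma>. \<sigma> permutes {1..n} \<and> (\<forall>i\<in>{1..n}. y i = x (\<sigma> i))" by auto
next
  assume "\<exists>\<sigma>. \<sigma> permutes {1..n} \<and> (\<forall>i\<in>{1..n}. y i = x (\<sigma> i))"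
  then obtain \<sigma> where p: "\<sigma> permutes {1..n}" and y: "\<forall>i\<in>{1..n}. y i = x (\<sigma> i)" by blast
  have "tuple_mset n y = image_mset x (image_mset \<sigma> (mset_set {1..n}))"
    unfolding tuple_mset_def multiset.map_comp by (rule image_mset_cong) (use y in auto)
  also have "image_mset \<sigma> (mset_set {1..n}) = mset_set {1..n}"
    using p by (simp add: permutes_inj_on permutes_image image_mset_mset_set)
  finally show "tuple_mset n x = tuple_mset n y" by (simp add: tuple_mset_def)
qed


section \<open>Complex algebras, Frobenius homomorphisms and transfers\<close>

definition complex_ring :: "complex ring" where
  "complex_ring = \<lparr>carrier = UNIV, monoid.mult = (*), one = 1, ring.zero = 0, add = (+)\<rparr>"

text \<open>Commutative unital \<open>\<complex>\<close>-algebras are structures \<open>A\<close> with \<open>algebra complex_ring A\<close>.\<close>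

definition linear_maps :: "(complex, 'a) module \<Rightarrow> (complex, 'b) module \<Rightarrow> ('a \<Rightarrow> 'b) set" where
  "linear_maps A B = {f \<in> carrier A \<rightarrow> carrier B.
     (\<forall>a\<in>carrier A. \<forall>b\<in>carrier A. f (a \<oplus>\<^bsub>A\<^esub> b) = f a \<oplus>\<^bsub>B\<^esub> f b) \<and>
     (\<forall>c. \<forall>a\<in>carrier A. f (c \<odot>\<^bsub>A\<^esub> a) = c \<odot>\<^bsub>B\<^esub> f a)}"

text \<open>The cycles of \<open>\<sigma>\<close>, fixed points included, are given by its orbits on \<open>{1..n}\<close>; since
  \<open>A\<close> is commutative, \<open>f\<^sub>\<gamma>\<close> only depends on the set of indices occurring in \<open>\<gamma>\<close>.
  The multilinear map \<open>\<Phi>\<^sub>n(f)\<close> on \<open>A\<^sup>\<otimes>\<^sup>n\<close> is given by its values on the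
  tensors \<open>a\<^sub>1 \<otimes> \<dots> \<otimes> a\<^sub>n\<close>.\<close>

definition Frob_Phi ::
    "(complex, 'a) module \<Rightarrow> (complex, 'b) module \<Rightarrow> nat \<Rightarrow> ('a \<Rightarrow> 'b) \<Rightarrow> (nat \<Rightarrow> 'a) \<Rightarrow> 'b" where
  "Frob_Phi A B n f a =
     (\<Oplus>\<^bsub>B\<^esub>\<sigma>\<in>{\<sigma>. \<sigma> permutes {1..n}}.
        of_int (sign \<sigma>) \<odot>\<^bsub>B\<^esub> (\<Otimes>\<^bsub>B\<^esub>\<gamma>\<in>orbit \<sigma> ` {1..n}. f (\<Otimes>\<^bsub>A\<^esub>i\<in>\<gamma>. a i)))"

text \<open>For \<open>n = 0\<close> the second condition reads \<open>f = 0\<close>, because \<open>\<Phi>\<^sub>1(f) = f\<close>.\<close>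

definition Frobenius_hom ::
    "nat \<Rightarrow> (complex, 'a) module \<Rightarrow> (complex, 'b) module \<Rightarrow> ('a \<Rightarrow> 'b) \<Rightarrow> bool" where
  "Frobenius_hom n A B f \<longleftrightarrow>
     f \<in> linear_maps A B \<and>
     f \<one>\<^bsub>A\<^esub> = of_nat n \<odot>\<^bsub>B\<^esub> \<one>\<^bsub>B\<^esub> \<and>
     (\<forall>a \<in> {1..Suc n} \<rightarrow> carrier A. Frob_Phi A B (Suc n) f a = \<zero>\<^bsub>B\<^esub>)"

text \<open>Only meaningful for \<open>n \<ge> 1\<close>, because of the Frobenius \<open>(n-1)\<close>-homomorphism.\<close>

definition is_transfer ::
    "nat \<Rightarrow> (complex, 'a) module \<Rightarrow> (complex, 'b) module \<Rightarrow> ('a \<Rightarrow> 'b) \<Rightarrow> ('b \<Rightarrow> 'a) \<Rightarrow> bool" where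
  "is_transfer n A B f \<tau> \<longleftrightarrow>
     f \<in> ring_hom A B \<and>
     Frobenius_hom n B A \<tau> \<and>
     (\<forall>a\<in>carrier A. \<forall>b\<in>carrier B. \<tau> (f a \<otimes>\<^bsub>B\<^esub> b) = a \<otimes>\<^bsub>A\<^esub> \<tau> b) \<and>
     (\<exists>g. Frobenius_hom (n - 1) B B g \<and> (\<forall>b\<in>carrier B. f (\<tau> b) = b \<oplus>\<^bsub>B\<^esub> g b))"

lemma cring_complex_ring: "cring complex_ring"
proof (rule cringI)
  show "abelian_group complex_ring"
    by (rule abelian_groupI) (auto simp: complex_ring_def intro: exI[of _ "- x" for x])
  show "Group.comm_monoid complex_ring"
    by (rule comm_monoidI) (auto simp: complex_ring_def)
qed (auto simp: complex_ring_def algebra_simps)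

lemma Frobenius_hom_0_iff:
  assumes A: "algebra complex_ring A" and B: "algebra complex_ring B"
  shows "Frobenius_hom 0 A B f \<longleftrightarrow> f \<in> linear_maps A B \<and> (\<forall>a\<in>carrier A. f a = \<zero>\<^bsub>B\<^esub>)"
proof -
  interpret A: algebra complex_ring A by fact
  interpret B: algebra complex_ring B by fact
  have orb: "orbit id (Suc 0) = {Suc 0}"
    by (auto simp: orbit_altdef intro: exI[of _ 1])
  have one: "1 \<odot>\<^bsub>B\<^esub> b = b" if "b \<in> carrier B" for b
    using B.smult_one[OF that] by (simp add: complex_ring_def)
  have zero: "0 \<odot>\<^bsub>B\<^esub> \<one>\<^bsub>B\<^esub> = \<zero>\<^bsub>B\<^esub>"
    using B.smult_l_null[of "\<one>\<^bsub>B\<^esub>"] by (simp add: complex_ring_def)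
  have set1: "{\<sigma>. \<sigma> permutes {Suc 0}} = {id}" by auto
  have Phi: "Frob_Phi A B (Suc 0) f a = f (a 1)"
    if "a 1 \<in> carrier A" "f \<in> linear_maps A B" for a
  proof -
    have "f (a (Suc 0)) \<in> carrier B" using that by (auto simp: linear_maps_def)
    moreover have "a (Suc 0) \<in> carrier A" using that by simp
    ultimately show ?thesis
      by (simp add: Frob_Phi_def set1 orb one sign_id)
  qed
  show ?thesis
  proof
    assume F: "Frobenius_hom 0 A B f"
    have "f a = \<zero>\<^bsub>B\<^esub>" if "a \<in> carrier A" for a
      using F Phi[of "\<lambda>_. a"] that by (auto simp: Frobenius_hom_def)
    with F show "f \<in> linear_maps A B \<and> (\<forall>a\<in>carrier A. f a = \<zero>\<^bsub>B\<^esub>)"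
      by (auto simp: Frobenius_hom_def)
  next
    assume "f \<in> linear_maps A B \<and> (\<forall>a\<in>carrier A. f a = \<zero>\<^bsub>B\<^esub>)"
    then show "Frobenius_hom 0 A B f"
      by (auto simp: Frobenius_hom_def zero Phi Pi_iff)
  qed
qed


section \<open>The algebra of continuous functions and the induced maps\<close>

text \<open>Continuous functions are taken extensional (\<open>undefined\<close> off \<open>topspace X\<close>), so that equality
  in the carrier is equality of functions on \<open>X\<close>. The supremum norm plays no role for
  the algebraic notions above and is not part of the structure.\<close>

definition C_alg :: "'a topology \<Rightarrow> (complex, 'a \<Rightarrow> complex) module" where
  "C_alg X = \<lparr>carrier = {\<phi> \<in> extensional (topspace X). continuous_map X euclidean \<phi>},
     monoid.mult = (\<lambda>\<phi> \<psi>. \<lambda>x\<in>topspace X. \<phi> x * \<psi> x),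
     one = (\<lambda>x\<in>topspace X. 1),
     ring.zero = (\<lambda>x\<in>topspace X. 0),
     add = (\<lambda>\<phi> \<psi>. \<lambda>x\<in>topspace X. \<phi> x + \<psi> x),
     smult = (\<lambda>c \<phi>. \<lambda>x\<in>topspace X. c * \<phi> x)\<rparr>"

definition pullback :: "'a topology \<Rightarrow> ('a \<Rightarrow> 'b) \<Rightarrow> ('b \<Rightarrow> complex) \<Rightarrow> 'a \<Rightarrow> complex" where
  "pullback X h \<psi> = (\<lambda>x\<in>topspace X. \<psi> (h x))"

definition direct_image ::
    "'b topology \<Rightarrow> ('b \<Rightarrow> 'a multiset) \<Rightarrow> ('a \<Rightarrow> complex) \<Rightarrow> 'b \<Rightarrow> complex" where
  "direct_image Y t \<phi> = (\<lambda>y\<in>topspace Y. \<Sum>x\<in>#t y. \<phi> x)"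

lemma continuous_map_mult_complex:
  fixes f g :: "'a \<Rightarrow> complex"
  assumes "continuous_map X euclidean f" "continuous_map X euclidean g"
  shows "continuous_map X euclidean (\<lambda>x. f x * g x)"
  using assms by (auto simp: continuous_map_atin intro: tendsto_mult)

lemma algebra_C_alg: "algebra complex_ring (C_alg X)"
proof (rule algebraI)
  have cong: "continuous_map X euclidean (\<lambda>x\<in>topspace X. f x) \<longleftrightarrow> continuous_map X euclidean f"
    for f :: "'a \<Rightarrow> complex"
    by (metis (no_types, lifting) continuous_map_eq restrict_apply')
  note [simp] = cong C_alg_def
  note [intro] = continuous_map_add continuous_map_mult_complex continuous_map_minus
  show "cring complex_ring" by (rule cring_complex_ring)
  show "cring (C_alg X)"
  proof (rule cringI)
    show "abelian_group (C_alg X)"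
    proof (rule abelian_groupI)
      fix \<phi> assume \<phi>: "\<phi> \<in> carrier (C_alg X)"
      then show "\<exists>\<psi>\<in>carrier (C_alg X). \<psi> \<oplus>\<^bsub>C_alg X\<^esub> \<phi> = \<zero>\<^bsub>C_alg X\<^esub>"
        by (intro bexI[of _ "\<lambda>x\<in>topspace X. - \<phi> x"]) (auto simp: continuous_map_minus)
    qed (auto simp: extensional_def fun_eq_iff)
    show "Group.comm_monoid (C_alg X)"
      by (rule comm_monoidI) (auto simp: extensional_def fun_eq_iff)
  qed (auto simp: fun_eq_iff algebra_simps)
qed (auto simp: C_alg_def complex_ring_def extensional_def fun_eq_iff algebra_simps
      intro: continuous_map_mult_complex continuous_map_add)

end

theory Submission
  imports Defs
begin

text \<open>Evaluated at a point, \<open>t\<^sub>!\<close> is a sum of \<open>n\<close> evaluation characters, and the complement of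
  the identity in \<open>h\<^sup>* t\<^sub>!\<close> is a sum of \<open>n - 1\<close> of them, since \<open>x\<close> belongs to \<open>t (h x)\<close>. For a sum of
  \<open>m\<close> characters, expanding the products over the cycles turns \<open>\<Phi>\<^sub>k\<close> into a sum over maps
  \<open>r : {1..k} \<rightarrow> {1..m}\<close>, each weighted by the signed count of the permutations that leave \<open>r\<close>
  invariant. If \<open>m < k\<close>, this invariance group contains a transposition, so every weight vanishes.\<close>

section \<open>Cycle sums of power sums\<close>

text \<open>If \<open>r a = r b\<close> with \<open>a \<noteq> b\<close>, composing with the
  transposition of \<open>a\<close> and \<open>b\<close> maps the invariance group of
  \<open>r\<close> to itself. This map is an involution and reverses signs, so the sum equals its
  own negative.\<close>

lemma sum_sign_invariant_eq_0:
  assumes "finite S" and "\<not> inj_on r S"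
  shows "(\<Sum>\<sigma> | \<sigma> permutes S \<and> (\<forall>i\<in>S. r (\<sigma> i) = r i). sign \<sigma>) = 0"
proof -
  let ?G = "{\<sigma>. \<sigma> permutes S \<and> (\<forall>i\<in>S. r (\<sigma> i) = r i)}"
  obtain a b where ab: "a \<in> S" "b \<in> S" "a \<noteq> b" "r a = r b"
    using assms(2) by (auto simp: inj_on_def)
  let ?\<tau> = "Transposition.transpose a b"
  have r: "r (?\<tau> i) = r i" for i
    using ab by (simp add: Transposition.transpose_def)
  have mem: "?\<tau> \<circ> \<sigma> \<in> ?G" if "\<sigma> \<in> ?G" for \<sigma>
    using that ab by (auto simp: r intro: permutes_compose permutes_swap_id)
  have invol: "?\<tau> \<circ> (?\<tau> \<circ> \<sigma>) = \<sigma>" for \<sigma> :: "'a \<Rightarrow> 'a"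
    by (simp add: fun_eq_iff)
  have "(\<Sum>\<sigma>\<in>?G. sign \<sigma>) = (\<Sum>\<sigma>\<in>?G. sign (?\<tau> \<circ> \<sigma>))"
    by (rule sum.reindex_bij_witness[of _ "\<lambda>\<sigma>. ?\<tau> \<circ> \<sigma>" "\<lambda>\<sigma>. ?\<tau> \<circ> \<sigma>"])
      (use mem in \<open>simp_all only: invol\<close>)
  also have "\<dots> = (\<Sum>\<sigma>\<in>?G. - sign \<sigma>)"
  proof (rule sum.cong)
    fix \<sigma> assume "\<sigma> \<in> ?G"
    then have "permutation \<sigma>" using assms(1) by (auto simp: permutation_permutes)
    then show "sign (?\<tau> \<circ> \<sigma>) = - sign \<sigma>"
      using ab by (simp add: sign_compose permutation_swap_id sign_swap_id)
  qed simp
  finally show ?thesis by (simp add: sum_negf)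
qed

text \<open>Expanding the product chooses an element of \<open>R\<close> for each cycle. Such
  choices \<open>k\<close> are the same as functions \<open>r\<close> on \<open>S\<close> that are
  constant on cycles, that is, invariant under \<open>\<sigma>\<close>.\<close>

lemma prod_orbits_sum:
  fixes c :: "'i \<Rightarrow> 'r \<Rightarrow> 'c :: comm_semiring_1"
  assumes "finite S" and "finite R" and \<sigma>: "\<sigma> permutes S"
  shows "(\<Prod>\<gamma>\<in>orbit \<sigma> ` S. \<Sum>r\<in>R. \<Prod>i\<in>\<gamma>. c i r) =
    (\<Sum>r | r \<in> S \<rightarrow>\<^sub>E R \<and> (\<forall>i\<in>S. r (\<sigma> i) = r i). \<Prod>i\<in>S. c i (r i))"
proof -
  have perm: "permutation \<sigma>" using assms by (auto simp: permutation_permutes)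
  have self: "i \<in> orbit \<sigma> i" for i by (rule permutation_self_in_orbit[OF perm])
  have sub: "orbit \<sigma> i \<subseteq> S" if "i \<in> S" for i by (rule permutes_orbit_subset[OF \<sigma> that])
  have eq: "orbit \<sigma> j = orbit \<sigma> i" if "j \<in> orbit \<sigma> i" for i j
    using that orbit_swap[OF self that] by (blast intro: orbit_trans)
  have step: "orbit \<sigma> (\<sigma> i) = orbit \<sigma> i" for i by (rule permutation_orbit_step[OF perm])
  \<comment> \<open>Invariance under one application of \<open>\<sigma>\<close> propagates along the
    whole orbit.\<close>
  have inv: "r j = r i" if r: "\<forall>i\<in>S. r (\<sigma> i) = r i" and i: "i \<in> S" and j: "j \<in> orbit \<sigma> i"
    for r :: "'i \<Rightarrow> 'r" and i j
    using j
  proof induct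
    case base
    then show ?case using r i by blast
  next
    case (step j)
    then have "j \<in> S" using sub[OF i] by blast
    with step r show ?case by metis
  qed
  \<comment> \<open>The fibres of \<open>orbit \<sigma>\<close> on \<open>S\<close> are the orbits
    themselves; this allows a product over \<open>S\<close> to be grouped by cycles.\<close>
  have fib: "{j \<in> S. orbit \<sigma> j = orbit \<sigma> i} = orbit \<sigma> i" if "i \<in> S" for i
    using eq self sub[OF that] by blast
  have "(\<Prod>\<gamma>\<in>orbit \<sigma> ` S. \<Sum>r\<in>R. \<Prod>i\<in>\<gamma>. c i r) =
      (\<Sum>k\<in>orbit \<sigma> ` S \<rightarrow>\<^sub>E R. \<Prod>\<gamma>\<in>orbit \<sigma> ` S. \<Prod>i\<in>\<gamma>. c i (k \<gamma>))"
    using assms by (intro prod_sum_PiE) auto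
  also have "\<dots> = (\<Sum>k\<in>orbit \<sigma> ` S \<rightarrow>\<^sub>E R. \<Prod>i\<in>S. c i (k (orbit \<sigma> i)))"
  proof (rule sum.cong)
    fix k :: "'i set \<Rightarrow> 'r"
    have "(\<Prod>i\<in>S. c i (k (orbit \<sigma> i))) =
      (\<Prod>\<gamma>\<in>orbit \<sigma> ` S. \<Prod>i | i \<in> S \<and> orbit \<sigma> i = \<gamma>. c i (k (orbit \<sigma> i)))"
      by (rule prod.image_gen[OF assms(1)])
    also have "\<dots> = (\<Prod>\<gamma>\<in>orbit \<sigma> ` S. \<Prod>i\<in>\<gamma>. c i (k \<gamma>))"
      using fib by (intro prod.cong) (auto dest: eq)
    finally show "(\<Prod>\<gamma>\<in>orbit \<sigma> ` S. \<Prod>i\<in>\<gamma>. c i (k \<gamma>)) = (\<Prod>i\<in>S. c i (k (orbit \<sigma> i)))" ..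
  qed simp
  also have "\<dots> = (\<Sum>r | r \<in> S \<rightarrow>\<^sub>E R \<and> (\<forall>i\<in>S. r (\<sigma> i) = r i). \<Prod>i\<in>S. c i (r i))"
  \<comment> \<open>A choice on cycles is pulled back along \<open>orbit \<sigma>\<close>.
    Conversely, an invariant \<open>r\<close> is read off at a representative of each cycle picked
    by \<open>SOME\<close>; by \<open>inv\<close> its value does not depend on the
    representative.\<close>
  proof (rule sum.reindex_bij_witness[of _
      "\<lambda>r. \<lambda>\<gamma>\<in>orbit \<sigma> ` S. r (SOME i. i \<in> \<gamma>)" "\<lambda>k. \<lambda>i\<in>S. k (orbit \<sigma> i)"])
    have some: "(SOME j. j \<in> orbit \<sigma> i) \<in> orbit \<sigma> i" for i
      using self by (rule someI)
    fix k assume k: "k \<in> orbit \<sigma> ` S \<rightarrow>\<^sub>E R"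
    show "(\<lambda>\<gamma>\<in>orbit \<sigma> ` S. (\<lambda>i\<in>S. k (orbit \<sigma> i)) (SOME i. i \<in> \<gamma>)) = k"
    proof
      fix \<gamma>
      show "(\<lambda>\<gamma>\<in>orbit \<sigma> ` S. (\<lambda>i\<in>S. k (orbit \<sigma> i)) (SOME i. i \<in> \<gamma>)) \<gamma> = k \<gamma>"
      proof (cases "\<gamma> \<in> orbit \<sigma> ` S")
        case True
        then obtain i where i: "i \<in> S" "\<gamma> = orbit \<sigma> i" by blast
        with some[of i] sub[OF i(1)] eq[OF some[of i]] show ?thesis by auto
      next
        case False
        with k show ?thesis by (auto simp: PiE_def extensional_def)
      qed
    qed
    show "(\<lambda>i\<in>S. k (orbit \<sigma> i)) \<in> {r. r \<in> S \<rightarrow>\<^sub>E R \<and> (\<forall>i\<in>S. r (\<sigma> i) = r i)}"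
      using k permutes_in_image[OF \<sigma>] by (auto simp: step)
    show "(\<Prod>i\<in>S. c i ((\<lambda>i\<in>S. k (orbit \<sigma> i)) i)) = (\<Prod>i\<in>S. c i (k (orbit \<sigma> i)))"
      by (intro prod.cong) auto
  next
    have some: "(SOME j. j \<in> orbit \<sigma> i) \<in> orbit \<sigma> i" for i
      using self by (rule someI)
    fix r assume r: "r \<in> {r. r \<in> S \<rightarrow>\<^sub>E R \<and> (\<forall>i\<in>S. r (\<sigma> i) = r i)}"
    have val: "r (SOME j. j \<in> orbit \<sigma> i) = r i" if "i \<in> S" for i
      using inv[OF _ that some[of i]] r by blast
    show "(\<lambda>i\<in>S. (\<lambda>\<gamma>\<in>orbit \<sigma> ` S. r (SOME i. i \<in> \<gamma>)) (orbit \<sigma> i)) = r"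
      using r val by (auto simp: PiE_def extensional_def)
    show "(\<lambda>\<gamma>\<in>orbit \<sigma> ` S. r (SOME i. i \<in> \<gamma>)) \<in> orbit \<sigma> ` S \<rightarrow>\<^sub>E R"
      using r val by auto
  qed
  finally show ?thesis .
qed

text \<open>After expansion and exchange of the two sums, each \<open>r\<close> from
  \<open>S\<close> to \<open>R\<close> is weighted by the sum of signs over its invariance group. By
  the pigeonhole principle no \<open>r\<close> is injective, so all weights vanish.\<close>

lemma sum_sign_prod_orbits_eq_0:
  fixes c :: "'i \<Rightarrow> 'r \<Rightarrow> 'c :: comm_ring_1"
  assumes "finite S" and "finite R" and "card R < card S"
  shows "(\<Sum>\<sigma> | \<sigma> permutes S. of_int (sign \<sigma>) * (\<Prod>\<gamma>\<in>orbit \<sigma> ` S. \<Sum>r\<in>R. \<Prod>i\<in>\<gamma>. c i r)) = 0"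
proof -
  let ?I = "\<lambda>\<sigma> r. \<forall>i\<in>S. r (\<sigma> i) = r i"
  have "(\<Sum>\<sigma> | \<sigma> permutes S. of_int (sign \<sigma>) * (\<Prod>\<gamma>\<in>orbit \<sigma> ` S. \<Sum>r\<in>R. \<Prod>i\<in>\<gamma>. c i r)) =
      (\<Sum>\<sigma> | \<sigma> permutes S. \<Sum>r | r \<in> S \<rightarrow>\<^sub>E R \<and> ?I \<sigma> r. of_int (sign \<sigma>) * (\<Prod>i\<in>S. c i (r i)))"
    using assms by (intro sum.cong) (simp_all add: prod_orbits_sum sum_distrib_left)
  also have "\<dots> = (\<Sum>r\<in>S \<rightarrow>\<^sub>E R. \<Sum>\<sigma> | \<sigma> \<in> {\<sigma>. \<sigma> permutes S} \<and> ?I \<sigma> r.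
      of_int (sign \<sigma>) * (\<Prod>i\<in>S. c i (r i)))"
    using assms by (intro sum.swap_restrict) (auto intro: finite_permutations finite_PiE)
  also have "\<dots> = 0"
  proof (rule sum.neutral, rule ballI)
    fix r assume "r \<in> S \<rightarrow>\<^sub>E R"
    then have "r ` S \<subseteq> R" by auto
    then have "\<not> inj_on r S"
      using card_inj_on_le[of r S R] assms(2,3) by linarith
    from sum_sign_invariant_eq_0[OF assms(1) this]
    have "of_int (\<Sum>\<sigma> | \<sigma> permutes S \<and> ?I \<sigma> r. sign \<sigma>) * (\<Prod>i\<in>S. c i (r i)) = 0"
      by simp
    then show "(\<Sum>\<sigma> | \<sigma> \<in> {\<sigma>. \<sigma> permutes S} \<and> ?I \<sigma> r. of_int (sign \<sigma>) * (\<Prod>i\<in>S. c i (r i))) = 0"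
      by (simp add: sum_distrib_right)
  qed
  finally show ?thesis .
qed

text \<open>The multiset is listed and \<open>R\<close> is taken to be the set of positions in the
  list. Thus repeated points count separately and \<open>card R\<close> is
  \<open>size M\<close>.\<close>

lemma sum_sign_prod_orbits_mset_eq_0:
  fixes c :: "'i \<Rightarrow> 'x \<Rightarrow> 'c :: comm_ring_1"
  assumes "finite S" and "size M < card S"
  shows "(\<Sum>\<sigma> | \<sigma> permutes S. of_int (sign \<sigma>) * (\<Prod>\<gamma>\<in>orbit \<sigma> ` S. \<Sum>x\<in>#M. \<Prod>i\<in>\<gamma>. c i x)) = 0"
proof -
  obtain xs where M: "M = mset xs" by (metis ex_mset)
  have "(\<Sum>x\<in>#M. f x) = (\<Sum>r\<in>{0..<length xs}. f (xs ! r))" for f :: "'x \<Rightarrow> 'c"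
    unfolding M mset_map[symmetric] sum_mset_sum_list by (simp add: sum_list_sum_nth)
  then show ?thesis
    using sum_sign_prod_orbits_eq_0[of S "{0..<length xs}" "\<lambda>i r. c i (xs ! r)"] assms M by simp
qed

section \<open>Pointwise sums of characters on algebras of continuous functions\<close>

lemma restrict_in_C_alg_iff:
  "(\<lambda>x\<in>topspace X. f x) \<in> carrier (C_alg X) \<longleftrightarrow> continuous_map X euclidean f"
proof -
  have "continuous_map X euclidean (\<lambda>x\<in>topspace X. f x) \<longleftrightarrow> continuous_map X euclidean f"
    by (metis (no_types, lifting) continuous_map_eq restrict_apply')
  then show ?thesis by (simp add: C_alg_def)
qed

lemma C_alg_apply:
  assumes "x \<in> topspace X"
  shows "\<zero>\<^bsub>C_alg X\<^esub> x = 0" and "\<one>\<^bsub>C_alg X\<^esub> x = 1"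
    and "(\<phi> \<oplus>\<^bsub>C_alg X\<^esub> \<psi>) x = \<phi> x + \<psi> x"
    and "(\<phi> \<otimes>\<^bsub>C_alg X\<^esub> \<psi>) x = \<phi> x * \<psi> x"
    and "(c \<odot>\<^bsub>C_alg X\<^esub> \<phi>) x = c * \<phi> x"
  using assms by (simp_all add: C_alg_def)

text \<open>Together with the product version below, this makes evaluation at a point compatible
  with the finite sums and products in \<open>Frob_Phi\<close>, so that the Frobenius condition
  becomes an identity of complex numbers.\<close>

lemma C_alg_finsum_apply:
  assumes "x \<in> topspace X" and "\<And>i. i \<in> I \<Longrightarrow> f i \<in> carrier (C_alg X)" and "finite I"
  shows "(\<Oplus>\<^bsub>C_alg X\<^esub>i\<in>I. f i) x = (\<Sum>i\<in>I. f i x)"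
proof -
  interpret algebra complex_ring "C_alg X" by (rule algebra_C_alg)
  show ?thesis
    using assms(3,2)
  proof (induction I rule: finite_induct)
    case empty
    then show ?case using assms(1) by (simp add: C_alg_apply)
  next
    case (insert j J)
    then have "(\<Oplus>\<^bsub>C_alg X\<^esub>i\<in>insert j J. f i) = f j \<oplus>\<^bsub>C_alg X\<^esub> (\<Oplus>\<^bsub>C_alg X\<^esub>i\<in>J. f i)"
      by (intro finsum_insert) auto
    then show ?case using insert assms(1) by (simp add: C_alg_apply)
  qed
qed

lemma C_alg_finprod_apply:
  assumes "x \<in> topspace X" and "\<And>i. i \<in> I \<Longrightarrow> f i \<in> carrier (C_alg X)" and "finite I"
  shows "(\<Otimes>\<^bsub>C_alg X\<^esub>i\<in>I. f i) x = (\<Prod>i\<in>I. f i x)"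
proof -
  interpret algebra complex_ring "C_alg X" by (rule algebra_C_alg)
  show ?thesis
    using assms(3,2)
  proof (induction I rule: finite_induct)
    case empty
    then show ?case using assms(1) by (simp add: C_alg_apply)
  next
    case (insert j J)
    then have "(\<Otimes>\<^bsub>C_alg X\<^esub>i\<in>insert j J. f i) = f j \<otimes>\<^bsub>C_alg X\<^esub> (\<Otimes>\<^bsub>C_alg X\<^esub>i\<in>J. f i)"
      by (intro finprod_insert) auto
    then show ?case using insert assms(1) by (simp add: C_alg_apply)
  qed
qed

text \<open>Elements of the carrier are extensional, so their values on the space determine
  them.\<close>

lemma C_alg_eqI:
  assumes "\<phi> \<in> carrier (C_alg X)" and "\<psi> \<in> carrier (C_alg X)"
    and "\<And>x. x \<in> topspace X \<Longrightarrow> \<phi> x = \<psi> x"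
  shows "\<phi> = \<psi>"
  using assms by (auto simp: C_alg_def intro: extensionalityI)

text \<open>At each \<open>z\<close>, the map is a sum of \<open>m\<close> evaluation characters, to
  which the vanishing of signed cycle sums applies. The lemma serves both the direct image, with
  \<open>M = t\<close>, and the complement of the identity, with one point removed from
  \<open>t (h x)\<close>. Continuity enters through the assumption that \<open>F\<close> takes
  values in \<open>C_alg Z\<close>.\<close>

lemma Frobenius_hom_sum_of_characters:
  assumes F: "\<And>\<phi>. \<phi> \<in> carrier (C_alg X) \<Longrightarrow> F \<phi> \<in> carrier (C_alg Z)"
    and val: "\<And>\<phi> z. \<phi> \<in> carrier (C_alg X) \<Longrightarrow> z \<in> topspace Z \<Longrightarrow> F \<phi> z = (\<Sum>x\<in>#M z. \<phi> x)"
    and size: "\<And>z. z \<in> topspace Z \<Longrightarrow> size (M z) = m"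
    and sub: "\<And>z. z \<in> topspace Z \<Longrightarrow> set_mset (M z) \<subseteq> topspace X"
  shows "Frobenius_hom m (C_alg X) (C_alg Z) F"
proof -
  interpret X: algebra complex_ring "C_alg X" by (rule algebra_C_alg)
  interpret Z: algebra complex_ring "C_alg Z" by (rule algebra_C_alg)
  have smult_X: "c \<odot>\<^bsub>C_alg X\<^esub> \<phi> \<in> carrier (C_alg X)" if "\<phi> \<in> carrier (C_alg X)" for c \<phi>
    using X.smult_closed[of c \<phi>] that by (simp add: complex_ring_def)
  have smult_Z: "c \<odot>\<^bsub>C_alg Z\<^esub> \<phi> \<in> carrier (C_alg Z)" if "\<phi> \<in> carrier (C_alg Z)" for c \<phi>
    using Z.smult_closed[of c \<phi>] that by (simp add: complex_ring_def)
  \<comment> \<open>The operations of \<open>C_alg X\<close> follow the pointwise formulas on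
    \<open>topspace X\<close>; since all entries of \<open>M z\<close> lie there, the formulas may
    be used under the sum.\<close>
  have sum_cong: "(\<Sum>x\<in>#M z. \<phi> x) = (\<Sum>x\<in>#M z. \<psi> x)"
    if "z \<in> topspace Z" "\<And>x. x \<in> topspace X \<Longrightarrow> \<phi> x = \<psi> x" for \<phi> \<psi> :: "'a \<Rightarrow> complex" and z
    using sub[OF that(1)] that(2) by (intro arg_cong[where f = sum_mset] image_mset_cong) auto
  have add: "F (\<phi> \<oplus>\<^bsub>C_alg X\<^esub> \<psi>) = F \<phi> \<oplus>\<^bsub>C_alg Z\<^esub> F \<psi>"
    if \<phi>: "\<phi> \<in> carrier (C_alg X)" and \<psi>: "\<psi> \<in> carrier (C_alg X)" for \<phi> \<psi>
  proof (rule C_alg_eqI)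
    fix z assume z: "z \<in> topspace Z"
    have "F (\<phi> \<oplus>\<^bsub>C_alg X\<^esub> \<psi>) z = (\<Sum>x\<in>#M z. \<phi> x + \<psi> x)"
      unfolding val[OF X.a_closed[OF \<phi> \<psi>] z] by (rule sum_cong[OF z]) (simp add: C_alg_apply)
    then show "F (\<phi> \<oplus>\<^bsub>C_alg X\<^esub> \<psi>) z = (F \<phi> \<oplus>\<^bsub>C_alg Z\<^esub> F \<psi>) z"
      using val[OF \<phi> z] val[OF \<psi> z] z by (simp add: C_alg_apply sum_mset.distrib)
  qed (use \<phi> \<psi> F in auto)
  have smult: "F (c \<odot>\<^bsub>C_alg X\<^esub> \<phi>) = c \<odot>\<^bsub>C_alg Z\<^esub> F \<phi>"
    if \<phi>: "\<phi> \<in> carrier (C_alg X)" for c \<phi>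
  proof (rule C_alg_eqI)
    fix z assume z: "z \<in> topspace Z"
    have "F (c \<odot>\<^bsub>C_alg X\<^esub> \<phi>) z = (\<Sum>x\<in>#M z. c * \<phi> x)"
      unfolding val[OF smult_X[OF \<phi>] z] by (rule sum_cong[OF z]) (simp add: C_alg_apply)
    then show "F (c \<odot>\<^bsub>C_alg X\<^esub> \<phi>) z = (c \<odot>\<^bsub>C_alg Z\<^esub> F \<phi>) z"
      using val[OF \<phi> z] z by (simp add: C_alg_apply sum_mset_distrib_left)
  qed (use \<phi> F smult_X smult_Z in auto)
  have one: "F \<one>\<^bsub>C_alg X\<^esub> = of_nat m \<odot>\<^bsub>C_alg Z\<^esub> \<one>\<^bsub>C_alg Z\<^esub>"
  proof (rule C_alg_eqI)
    fix z assume z: "z \<in> topspace Z"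
    have "F \<one>\<^bsub>C_alg X\<^esub> z = (\<Sum>x\<in>#M z. 1)"
      unfolding val[OF X.one_closed z] by (rule sum_cong[OF z]) (simp add: C_alg_apply)
    then show "F \<one>\<^bsub>C_alg X\<^esub> z = (of_nat m \<odot>\<^bsub>C_alg Z\<^esub> \<one>\<^bsub>C_alg Z\<^esub>) z"
      using z size by (simp add: C_alg_apply)
  qed (use F smult_Z in auto)
  have Phi: "Frob_Phi (C_alg X) (C_alg Z) (Suc m) F a = \<zero>\<^bsub>C_alg Z\<^esub>"
    if a: "a \<in> {1..Suc m} \<rightarrow> carrier (C_alg X)" for a
  proof -
    let ?S = "{1..Suc m}" and ?P = "\<lambda>\<gamma>. \<Otimes>\<^bsub>C_alg X\<^esub>i\<in>\<gamma>. a i"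
    have cyc: "\<gamma> \<subseteq> ?S" if "\<sigma> permutes ?S" "\<gamma> \<in> orbit \<sigma> ` ?S" for \<sigma> \<gamma>
      using permutes_orbit_subset[OF that(1)] that(2) by blast
    have P: "?P \<gamma> \<in> carrier (C_alg X)" if "\<gamma> \<subseteq> ?S" for \<gamma>
      using a that by (intro X.finprod_closed) auto
    \<comment> \<open>Characters are multiplicative, so each cycle factor takes the form required by
      the cycle sum lemma, with \<open>c i x = a i x\<close>.\<close>
    have FP: "F (?P \<gamma>) z = (\<Sum>x\<in>#M z. \<Prod>i\<in>\<gamma>. a i x)" if "\<gamma> \<subseteq> ?S" "z \<in> topspace Z" for \<gamma> z
      unfolding val[OF P[OF that(1)] that(2)]
    proof (rule sum_cong[OF that(2)])
      fix x assume "x \<in> topspace X"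
      then show "?P \<gamma> x = (\<Prod>i\<in>\<gamma>. a i x)"
        using that(1) a by (intro C_alg_finprod_apply) (auto intro: finite_subset)
    qed
    have Q: "(\<Otimes>\<^bsub>C_alg Z\<^esub>\<gamma>\<in>orbit \<sigma> ` ?S. F (?P \<gamma>)) \<in> carrier (C_alg Z)"
      if "\<sigma> permutes ?S" for \<sigma>
      using P F cyc[OF that] by (intro Z.finprod_closed) auto
    have T: "of_int (sign \<sigma>) \<odot>\<^bsub>C_alg Z\<^esub> (\<Otimes>\<^bsub>C_alg Z\<^esub>\<gamma>\<in>orbit \<sigma> ` ?S. F (?P \<gamma>)) \<in> carrier (C_alg Z)"
      if "\<sigma> permutes ?S" for \<sigma>
      by (intro smult_Z Q that)
    show ?thesis
    proof (rule C_alg_eqI)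
      show "Frob_Phi (C_alg X) (C_alg Z) (Suc m) F a \<in> carrier (C_alg Z)"
        unfolding Frob_Phi_def using T by (intro Z.finsum_closed) auto
      fix z assume z: "z \<in> topspace Z"
      have "Frob_Phi (C_alg X) (C_alg Z) (Suc m) F a z = (\<Sum>\<sigma> | \<sigma> permutes ?S.
          (of_int (sign \<sigma>) \<odot>\<^bsub>C_alg Z\<^esub> (\<Otimes>\<^bsub>C_alg Z\<^esub>\<gamma>\<in>orbit \<sigma> ` ?S. F (?P \<gamma>))) z)"
        unfolding Frob_Phi_def
        using T finite_permutations[of ?S] by (intro C_alg_finsum_apply[OF z]) auto
      also have "\<dots> = (\<Sum>\<sigma> | \<sigma> permutes ?S.
          of_int (sign \<sigma>) * (\<Prod>\<gamma>\<in>orbit \<sigma> ` ?S. \<Sum>x\<in>#M z. \<Prod>i\<in>\<gamma>. a i x))"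
      proof (rule sum.cong)
        fix \<sigma> assume "\<sigma> \<in> {\<sigma>. \<sigma> permutes ?S}"
        then have \<sigma>: "\<sigma> permutes ?S" by simp
        have "(\<Otimes>\<^bsub>C_alg Z\<^esub>\<gamma>\<in>orbit \<sigma> ` ?S. F (?P \<gamma>)) z = (\<Prod>\<gamma>\<in>orbit \<sigma> ` ?S. F (?P \<gamma>) z)"
          using P F cyc[OF \<sigma>] by (intro C_alg_finprod_apply[OF z]) auto
        also have "\<dots> = (\<Prod>\<gamma>\<in>orbit \<sigma> ` ?S. \<Sum>x\<in>#M z. \<Prod>i\<in>\<gamma>. a i x)"
          using FP[OF cyc[OF \<sigma>] z] by (intro prod.cong refl)
        finally show "(of_int (sign \<sigma>) \<odot>\<^bsub>C_alg Z\<^esub> (\<Otimes>\<^bsub>C_alg Z\<^esub>\<gamma>\<in>orbit \<sigma> ` ?S. F (?P \<gamma>))) z =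
            of_int (sign \<sigma>) * (\<Prod>\<gamma>\<in>orbit \<sigma> ` ?S. \<Sum>x\<in>#M z. \<Prod>i\<in>\<gamma>. a i x)"
          by (simp only: C_alg_apply(5)[OF z])
      qed simp
      also have "\<dots> = 0"
        \<comment> \<open>There are \<open>Suc m\<close> indices but only \<open>m\<close> entries
          in \<open>M z\<close>.\<close>
        using size[OF z] by (intro sum_sign_prod_orbits_mset_eq_0) auto
      finally show "Frob_Phi (C_alg X) (C_alg Z) (Suc m) F a z = \<zero>\<^bsub>C_alg Z\<^esub> z"
        using z by (simp add: C_alg_apply)
    qed simp
  qed
  show ?thesis
    unfolding Frobenius_hom_def linear_maps_def using F add smult one Phi by auto
qed

section \<open>Pullback and direct image\<close>

lemma pullback_in_C_alg:
  assumes "continuous_map X Y h" and "\<psi> \<in> carrier (C_alg Y)"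
  shows "pullback X h \<psi> \<in> carrier (C_alg X)"
  unfolding pullback_def restrict_in_C_alg_iff
  using assms continuous_map_compose[of X Y h euclidean \<psi>] by (simp add: C_alg_def o_def)

lemma pullback_ring_hom:
  assumes "continuous_map X Y h"
  shows "pullback X h \<in> ring_hom (C_alg Y) (C_alg X)"
proof (rule ring_hom_memI)
  have h: "h x \<in> topspace Y" if "x \<in> topspace X" for x
    using assms that by (auto simp: continuous_map_def)
  show "pullback X h \<one>\<^bsub>C_alg Y\<^esub> = \<one>\<^bsub>C_alg X\<^esub>"
    and "pullback X h (\<phi> \<otimes>\<^bsub>C_alg Y\<^esub> \<psi>) = pullback X h \<phi> \<otimes>\<^bsub>C_alg X\<^esub> pullback X h \<psi>"
    and "pullback X h (\<phi> \<oplus>\<^bsub>C_alg Y\<^esub> \<psi>) = pullback X h \<phi> \<oplus>\<^bsub>C_alg X\<^esub> pullback X h \<psi>"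
    for \<phi> \<psi>
    using h by (auto simp: pullback_def C_alg_def fun_eq_iff)
qed (rule pullback_in_C_alg[OF assms])

text \<open>By the universal property of the quotient, it suffices to check continuity on ordered
  tuples, where the function is a finite sum of \<open>\<phi>\<close> composed with coordinate
  projections.\<close>

lemma continuous_map_Sym_sum:
  fixes \<phi> :: "'a \<Rightarrow> complex"
  assumes "continuous_map X euclidean \<phi>"
  shows "continuous_map (Sym n X) euclidean (\<lambda>M. \<Sum>x\<in>#M. \<phi> x)"
proof (rule continuous_compose_quotient_map[OF quotient_map_Sym])
  have "(\<lambda>M. \<Sum>x\<in>#M. \<phi> x) \<circ> tuple_mset n = (\<lambda>p. \<Sum>i\<in>{1..n}. \<phi> (p i))"
    by (simp add: fun_eq_iff tuple_mset_def multiset.map_comp o_def sum_unfold_sum_mset)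
  moreover have "continuous_map (product_topology (\<lambda>_. X) {1..n}) euclidean (\<lambda>p. \<phi> (p i))"
    if "i \<in> {1..n}" for i
    using continuous_map_compose[OF continuous_map_product_projection[OF that] assms]
    by (simp add: o_def)
  ultimately show "continuous_map (product_topology (\<lambda>_. X) {1..n}) euclidean
      ((\<lambda>M. \<Sum>x\<in>#M. \<phi> x) \<circ> tuple_mset n)"
    by (simp only: continuous_map_sum finite_atLeastAtMost)
qed

text \<open>On \<open>Y\<close> the direct image is \<open>t\<close> followed by the continuous sum
  function on the symmetric product.\<close>

lemma direct_image_in_C_alg:
  assumes "continuous_map Y (Sym n X) t" and "\<phi> \<in> carrier (C_alg X)"
  shows "direct_image Y t \<phi> \<in> carrier (C_alg Y)"
  unfolding direct_image_def restrict_in_C_alg_iff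
  using assms continuous_map_compose[OF assms(1) continuous_map_Sym_sum, of \<phi>]
  by (simp add: C_alg_def o_def)

theorem theorem5p1:
  fixes X :: "'a topology" and Y :: "'b topology"
    and h :: "'a \<Rightarrow> 'b" and t :: "'b \<Rightarrow> 'a multiset" and n :: nat
  assumes "n \<ge> 1"
    and "compact_space X" and "Hausdorff_space X"
    and "compact_space Y" and "Hausdorff_space Y"
    and "branched_covering n X Y h t"
  shows "is_transfer n (C_alg Y) (C_alg X) (pullback X h) (direct_image Y t)"
proof -
  interpret X: algebra complex_ring "C_alg X" by (rule algebra_C_alg)
  interpret Y: algebra complex_ring "C_alg Y" by (rule algebra_C_alg)
  from assms(6) have h: "continuous_map X Y h" and t: "continuous_map Y (Sym n X) t"
    by (auto simp: branched_covering_def)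
  have mem: "x \<in># t (h x)" if "x \<in> topspace X" for x
    using assms(6) that by (auto simp: branched_covering_def)
  have fib: "image_mset h (t y) = replicate_mset n y" if "y \<in> topspace Y" for y
    using assms(6) that by (auto simp: branched_covering_def)
  have hY: "h x \<in> topspace Y" if "x \<in> topspace X" for x
    using h that by (auto simp: continuous_map_def)
  have size: "size (t y) = n" and sub: "set_mset (t y) \<subseteq> topspace X" if "y \<in> topspace Y" for y
    using continuous_map_image_subset_topspace[OF t] that by (auto simp: topspace_Sym)
  note t_closed = direct_image_in_C_alg[OF t]
  \<comment> \<open>Defined as a difference in the algebra, \<open>g \<phi>\<close> is continuous at
    once; the formula in \<open>g_val\<close> then exhibits it as a sum of characters.\<close>
  define g where "g \<phi> = pullback X h (direct_image Y t \<phi>) \<ominus>\<^bsub>C_alg X\<^esub> \<phi>" for \<phi>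
  have ht: "pullback X h (direct_image Y t \<phi>) \<in> carrier (C_alg X)"
    if "\<phi> \<in> carrier (C_alg X)" for \<phi>
    by (intro pullback_in_C_alg[OF h] t_closed that)
  have g: "g \<phi> \<in> carrier (C_alg X)" if "\<phi> \<in> carrier (C_alg X)" for \<phi>
    using ht that by (simp add: g_def)
  have split: "pullback X h (direct_image Y t \<phi>) = \<phi> \<oplus>\<^bsub>C_alg X\<^esub> g \<phi>"
    if "\<phi> \<in> carrier (C_alg X)" for \<phi>
    using ht[OF that] that X.a_lcomm[OF that ht[OF that] X.a_inv_closed[OF that]]
    by (simp add: g_def X.minus_eq X.r_neg)
  have g_val: "g \<phi> x = (\<Sum>w\<in>#t (h x) - {#x#}. \<phi> w)"
    if \<phi>: "\<phi> \<in> carrier (C_alg X)" and x: "x \<in> topspace X" for \<phi> x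
  proof -
    have "(\<Sum>w\<in>#t (h x). \<phi> w) = \<phi> x + g \<phi> x"
      using fun_cong[OF split[OF \<phi>], of x] x hY[OF x]
      by (simp add: pullback_def direct_image_def C_alg_def)
    \<comment> \<open>Since \<open>x\<close> occurs in \<open>t (h x)\<close>, one copy of it can be
      split off; any further copies stay in the remaining sum.\<close>
    moreover have "(\<Sum>w\<in>#t (h x). \<phi> w) = \<phi> x + (\<Sum>w\<in>#t (h x) - {#x#}. \<phi> w)"
      by (subst insert_DiffM[OF mem[OF x], symmetric]) simp
    ultimately show ?thesis by simp
  qed
  have "Frobenius_hom (n - 1) (C_alg X) (C_alg X) g"
  proof (rule Frobenius_hom_sum_of_characters[OF g g_val])
    fix x assume x: "x \<in> topspace X"
    \<comment> \<open>Exactly one entry is removed. For \<open>n = 1\<close> nothing remains and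
      \<open>g\<close> is zero on the carrier.\<close>
    show "size (t (h x) - {#x#}) = n - 1"
      using size[OF hY[OF x]] mem[OF x] by (simp add: size_Diff_singleton)
    show "set_mset (t (h x) - {#x#}) \<subseteq> topspace X"
      using sub[OF hY[OF x]] by (auto dest: in_diffD)
  qed
  moreover have "Frobenius_hom n (C_alg X) (C_alg Y) (direct_image Y t)"
    by (rule Frobenius_hom_sum_of_characters[OF t_closed _ size sub])
      (simp_all add: direct_image_def)
  moreover have "direct_image Y t (pullback X h \<psi> \<otimes>\<^bsub>C_alg X\<^esub> \<phi>) =
      \<psi> \<otimes>\<^bsub>C_alg Y\<^esub> direct_image Y t \<phi>"
    if \<psi>: "\<psi> \<in> carrier (C_alg Y)" and \<phi>: "\<phi> \<in> carrier (C_alg X)" for \<psi> \<phi>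
  proof (rule C_alg_eqI)
    fix y assume y: "y \<in> topspace Y"
    \<comment> \<open>All entries of \<open>t y\<close> lie over \<open>y\<close>, by the second
      condition on a branched covering. Hence the pullback of \<open>\<psi>\<close> takes the
      constant value \<open>\<psi> y\<close> on them and can be taken out of the sum.\<close>
    have hx: "h x = y" if "x \<in># t y" for x
      using imageI[OF that, of h] fib[OF y]
      by (metis in_replicate_mset set_image_mset)
    have "(\<Sum>x\<in>#t y. (pullback X h \<psi> \<otimes>\<^bsub>C_alg X\<^esub> \<phi>) x) = (\<Sum>x\<in>#t y. \<psi> y * \<phi> x)"
      using sub[OF y] hx
      by (intro arg_cong[where f = sum_mset] image_mset_cong) (auto simp: pullback_def C_alg_def)
    then show "direct_image Y t (pullback X h \<psi> \<otimes>\<^bsub>C_alg X\<^esub> \<phi>) y =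
        (\<psi> \<otimes>\<^bsub>C_alg Y\<^esub> direct_image Y t \<phi>) y"
      using y by (simp add: direct_image_def C_alg_def sum_mset_distrib_left)
  qed (intro t_closed X.m_closed Y.m_closed pullback_in_C_alg[OF h] \<psi> \<phi>)+
  ultimately show ?thesis
    unfolding is_transfer_def using pullback_ring_hom[OF h] split by blast
qed

end
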